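(* Let $X$ be a geodesic metric space. Suppose that for any points $x,y\in X$ and any positive real numbers $R$ and $R'\le R/2$, the set $B_x(R)\setminus B_y(R')$ is connected and non-empty. Let $Y$ be a tree, and let $f:B_x(R)\to Y$ be a $(\lambda_1,\lambda_2,c_1,c_2)$-quasi-isometric embedding. Then $$R\le 12\lambda_2c_1+4c_2.$$
   Context: $B_x(R)$ denotes the ball of radius $R$ centred at $x$. A tree is a metric tree (with its path metric). A map $f:E\to F$ between metric spaces is a $(\lambda_1,\lambda_2,c_1,c_2)$-quasi-isometric embedding ($\lambda_1,\lambda_2>0$, $c_1,c_2\ge0$) if for all $x,y\in E$, $\frac1{\lambda_2}(d(x,y)-c_2)\le d(f(x),f(y))\le\lambda_1d(x,y)+c_1$. *)

theory Defs
  imports "HOL-Analysis.Analysis"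
begin

definition geodesic_segment :: "'a::metric_space set \<Rightarrow> 'a \<Rightarrow> 'a \<Rightarrow> bool" where
  "geodesic_segment S x y \<longleftrightarrow>
     (\<exists>g :: real \<Rightarrow> 'a. g 0 = x \<and> g (dist x y) = y \<and>
        (\<forall>s\<in>{0..dist x y}. \<forall>t\<in>{0..dist x y}. dist (g s) (g t) = \<bar>s - t\<bar>) \<and>
        S = g ` {0..dist x y})"

(* The whole type is the space; the argument T only carries the type. *)
definition geodesic_space :: "'a::metric_space itself \<Rightarrow> bool" where
  "geodesic_space T \<longleftrightarrow> (\<forall>x y :: 'a. \<exists>S. geodesic_segment S x y)"

(* Metric trees in the sense of real trees (the definition of Bridson and Haefliger);
   simplicial trees with their path metric are examples.  Neither completeness nor
   local finiteness is required. *)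
definition metric_tree :: "'a::metric_space itself \<Rightarrow> bool" where
  "metric_tree T \<longleftrightarrow>
     (\<forall>x y :: 'a. \<exists>!S. geodesic_segment S x y) \<and>
     (\<forall>(x :: 'a) y z S S'. geodesic_segment S y x \<and> geodesic_segment S' x z \<and> S \<inter> S' = {x}
        \<longrightarrow> geodesic_segment (S \<union> S') y z)"

definition quasi_isometric_embedding_on ::
  "real \<Rightarrow> real \<Rightarrow> real \<Rightarrow> real \<Rightarrow> 'a::metric_space set \<Rightarrow> ('a \<Rightarrow> 'b::metric_space) \<Rightarrow> bool" where
  "quasi_isometric_embedding_on lam1 lam2 c1 c2 E f \<longleftrightarrow>
     lam1 > 0 \<and> lam2 > 0 \<and> c1 \<ge> 0 \<and> c2 \<ge> 0 \<and>
     (\<forall>x\<in>E. \<forall>y\<in>E. 1 / lam2 * (dist x y - c2) \<le> dist (f x) (f y) \<and>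
        dist (f x) (f y) \<le> lam1 * dist x y + c1)"

end

theory Submission imports Defs begin

text \<open>
  The bound comes from two different cut properties.  In a tree, a single point \<open>z\<close> of the
  segment from \<open>u\<close> to \<open>v\<close> separates \<open>u\<close> from \<open>v\<close>, so a map with error \<open>c1\<close> cannot carry a
  connected set from \<open>u\<close> to \<open>v\<close> without some image point coming (almost) \<open>c1\<close>-close to \<open>z\<close>
  (\<open>connected_image_near_cut_point\<close>).  In \<open>X\<close>, by contrast, removing a ball of half the radius
  does not disconnect a ball.

  Choose three points of \<open>B\<^sub>x(R)\<close> with mutual distances at least \<open>R/2\<close>, and let \<open>z\<close> be the
  centre of the tripod spanned by their images, so that \<open>z\<close> lies between any two of them.
  Connecting two of the three points outside the \<open>R/4\<close>-ball around the third gives a point \<open>p\<close>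
  with \<open>f p\<close> close to \<open>z\<close>.  At most one of the three points is within \<open>R/4\<close> of \<open>p\<close>, so
  the other two can be connected outside the \<open>R/4\<close>-ball around \<open>p\<close>, and this gives a point \<open>q\<close>
  with \<open>f q\<close> close to \<open>z\<close> as well.  Now \<open>f p\<close> and \<open>f q\<close> are \<open>2c1\<close>-close up to an arbitrarily
  small error, whereas \<open>p\<close> and \<open>q\<close> are \<open>R/4\<close> apart, so \<open>R \<le> 8\<lambda>\<^sub>2c1 + 4c2\<close>.

  The three-point choice is what keeps \<open>\<lambda>\<^sub>1\<close> out of the bound: that \<open>p\<close> is far from the two
  points to be connected follows from distances in \<open>X\<close> alone, never from distances between
  images.
\<close>

section \<open>Geodesic segments and tripods in metric trees\<close>

lemma geodesic_segment_subinterval: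
  fixes g :: "real \<Rightarrow> 'a::metric_space"
  assumes "\<And>s t. s \<in> {0..d} \<Longrightarrow> t \<in> {0..d} \<Longrightarrow> dist (g s) (g t) = \<bar>s - t\<bar>"
    and "0 \<le> a" "a \<le> b" "b \<le> d"
  shows "geodesic_segment (g ` {a..b}) (g a) (g b)"
proof -
  have d: "dist (g a) (g b) = b - a"
    using assms by auto
  have "g ` {a..b} = (\<lambda>u. g (a + u)) ` {0..b - a}"
    using image_add_atLeastAtMost[of a 0 "b - a"] by (simp flip: image_image)
  then show ?thesis
    unfolding geodesic_segment_def d
    using assms by (intro exI[of _ "\<lambda>u. g (a + u)"]) auto
qed

lemma geodesic_segment_commute:
  assumes "geodesic_segment S x y"
  shows "geodesic_segment S y x"
proof -
  obtain g where g: "g 0 = x" "g (dist x y) = y"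
    "\<And>s t. s \<in> {0..dist x y} \<Longrightarrow> t \<in> {0..dist x y} \<Longrightarrow> dist (g s) (g t) = \<bar>s - t\<bar>"
    "S = g ` {0..dist x y}"
    using assms unfolding geodesic_segment_def by blast
  have "S = (\<lambda>u. g (dist x y - u)) ` {0..dist x y}"
    using image_diff_atLeastAtMost[of "dist x y" 0 "dist x y"] g(4)
    by (simp flip: image_image)
  then show ?thesis
    unfolding geodesic_segment_def dist_commute[of y x]
    using g(1-3) by (intro exI[of _ "\<lambda>u. g (dist x y - u)"]) auto
qed

lemma metric_tree_segment_exists:
  fixes x y :: "'a::metric_space"
  assumes "metric_tree TYPE('a)"
  shows "\<exists>S. geodesic_segment S x y"
proof -
  have "\<exists>!S. geodesic_segment S x y"
    using assms unfolding metric_tree_def by simp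
  then show ?thesis by (rule ex1_implies_ex)
qed

lemma metric_tree_segment_unique:
  fixes x y :: "'a::metric_space"
  assumes "metric_tree TYPE('a)"
    and S: "geodesic_segment S x y" "geodesic_segment S' x y"
  shows "S = S'"
proof -
  have "\<exists>!S. geodesic_segment S x y"
    using assms(1) unfolding metric_tree_def by simp
  from ex1_iff_ex_Uniq[THEN iffD1, OF this] show ?thesis
    using S by (auto dest: Uniq_D)
qed

lemma metric_tree_segment_Un:
  fixes x y z :: "'a::metric_space"
  assumes "metric_tree TYPE('a)" "geodesic_segment S y x" "geodesic_segment S' x z"
    "S \<inter> S' = {x}"
  shows "geodesic_segment (S \<union> S') y z"
  using conjunct2[OF assms(1)[unfolded metric_tree_def], rule_format, of S y x S' z] assms(2-)
  by simp

text \<open>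
  The segments from \<open>p\<close> to \<open>q\<close> and from \<open>p\<close> to \<open>r\<close> run together up to a last common point \<open>c\<close>.
  Beyond \<open>c\<close> they are disjoint, since a common point would be reached by both at the same time,
  namely its distance from \<open>p\<close>; so the two remainders concatenate to the segment from \<open>q\<close> to
  \<open>r\<close>.
\<close>
lemma metric_tree_tripod:
  fixes p q r :: "'a::metric_space"
  assumes "metric_tree TYPE('a)"
  obtains c A B C where "c \<in> A" "c \<in> B" "c \<in> C"
    "geodesic_segment (A \<union> B) p q" "geodesic_segment (A \<union> C) p r"
    "geodesic_segment (B \<union> C) q r"
proof -
  obtain Sg Sh where Sg: "geodesic_segment Sg p q" and Sh: "geodesic_segment Sh p r"
    using metric_tree_segment_exists[OF assms] by meson
  define a b where "a = dist p q" and "b = dist p r"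
  obtain g where g: "g 0 = p" "g a = q"
    "\<And>s t. s \<in> {0..a} \<Longrightarrow> t \<in> {0..a} \<Longrightarrow> dist (g s) (g t) = \<bar>s - t\<bar>" "Sg = g ` {0..a}"
    using Sg unfolding geodesic_segment_def a_def by blast
  obtain h where h: "h 0 = p" "h b = r"
    "\<And>s t. s \<in> {0..b} \<Longrightarrow> t \<in> {0..b} \<Longrightarrow> dist (h s) (h t) = \<bar>s - t\<bar>" "Sh = h ` {0..b}"
    using Sh unfolding geodesic_segment_def b_def by blast
  have ab: "0 \<le> a" "0 \<le> b" by (auto simp: a_def b_def)
  have same_time: "s = t" if "g s = h t" "s \<in> {0..a}" "t \<in> {0..b}" for s t
  proof -
    have "s = dist (g 0) (g s)" "t = dist (h 0) (h t)"
      using that g(3)[of 0 s] h(3)[of 0 t] ab by auto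
    then show ?thesis using that(1) g(1) h(1) by metis
  qed
  define I where "I = {t \<in> {0..min a b}. dist (g t) (h t) = 0}"
  have "continuous_on {0..min a b} g" "continuous_on {0..min a b} h"
    using g(3) h(3) by (auto simp: continuous_on_iff dist_real_def)
  then have "continuous_on {0..min a b} (\<lambda>t. dist (g t) (h t))"
    by (intro continuous_intros)
  then have "closed I"
    unfolding I_def by (intro continuous_closed_preimage_constant) auto
  moreover have bdd: "bdd_above I"
    by (rule bdd_aboveI[of _ "min a b"]) (auto simp: I_def)
  moreover have "0 \<in> I"
    using ab g(1) h(1) by (auto simp: I_def)
  ultimately have SupI: "Sup I \<in> I"
    using closed_contains_Sup by blast
  define T where "T = Sup I"
  have T: "0 \<le> T" "T \<le> a" "T \<le> b" "g T = h T"
    using SupI by (auto simp: I_def T_def)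
  have last: "t = T" if "g t = h t" "t \<in> {T..min a b}" for t
    using that T cSup_upper[OF _ bdd, of t] by (auto simp: I_def T_def)
  have common: "g t = h t" if "t \<in> {0..T}" for t
  proof -
    have "geodesic_segment (g ` {0..T}) p (g T)"
      using geodesic_segment_subinterval[of a g 0 T] g(1,3) T by simp
    moreover have "geodesic_segment (h ` {0..T}) p (g T)"
      using geodesic_segment_subinterval[of b h 0 T] h(1,3) T by simp
    ultimately have same_image: "g ` {0..T} = h ` {0..T}"
      by (rule metric_tree_segment_unique[OF assms])
    have "g t \<in> g ` {0..T}"
      using that by (rule imageI)
    then obtain s where "s \<in> {0..T}" "g t = h s"
      unfolding same_image by (auto elim: imageE)
    moreover from this have "t = s"
      using same_time that T by auto
    ultimately show ?thesis by simp
  qed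
  have c: "g T \<in> g ` {0..T}" "g T \<in> g ` {T..a}" "g T \<in> h ` {T..b}"
    using T by (auto intro: image_eqI[of _ _ T])
  show thesis
  proof (rule that[of "g T" "g ` {0..T}" "g ` {T..a}" "h ` {T..b}"])
    have meet: "g ` {T..a} \<inter> h ` {T..b} = {g T}"
    proof
      show "g ` {T..a} \<inter> h ` {T..b} \<subseteq> {g T}"
      proof
        fix w assume "w \<in> g ` {T..a} \<inter> h ` {T..b}"
        then obtain s t where st: "s \<in> {T..a}" "t \<in> {T..b}" "w = g s" "w = h t"
          by blast
        moreover from this have "s = t"
          using same_time[of s t] T by auto
        ultimately show "w \<in> {g T}"
          using last[of s] by auto
      qed
    qed (use c in auto)
    have gq: "geodesic_segment (g ` {T..a}) q (g T)"
      using geodesic_segment_subinterval[of a g T a] g(2,3) T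
      by (simp add: geodesic_segment_commute)
    have hr: "geodesic_segment (h ` {T..b}) (g T) r"
      using geodesic_segment_subinterval[of b h T b] h(2,3) T by simp
    show "geodesic_segment (g ` {T..a} \<union> h ` {T..b}) q r"
      by (rule metric_tree_segment_Un[OF assms gq hr meet])
    have "g ` {0..T} \<union> g ` {T..a} = Sg"
      using T g(4) by (simp flip: image_Un add: ivl_disj_un_two_touch)
    then show "geodesic_segment (g ` {0..T} \<union> g ` {T..a}) p q"
      using Sg by simp
    have "g ` {0..T} = h ` {0..T}"
      using common by (rule image_cong[OF refl])
    then have "g ` {0..T} \<union> h ` {T..b} = Sh"
      using T h(4) by (simp flip: image_Un add: ivl_disj_un_two_touch)
    then show "geodesic_segment (g ` {0..T} \<union> h ` {T..b}) p r"
      using Sh by simp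
  qed (use c in auto)
qed

section \<open>Cut points of trees and images of connected sets\<close>

definition on_segment :: "'a::metric_space \<Rightarrow> 'a \<Rightarrow> 'a \<Rightarrow> bool" where
  "on_segment p z q \<longleftrightarrow> (\<exists>S. geodesic_segment S p q \<and> z \<in> S)"

lemma on_segment_dist_le:
  assumes "on_segment p z q"
  shows "dist p z \<le> dist p q"
proof -
  obtain g where g: "g 0 = p"
    "\<And>s t. s \<in> {0..dist p q} \<Longrightarrow> t \<in> {0..dist p q} \<Longrightarrow> dist (g s) (g t) = \<bar>s - t\<bar>"
    "z \<in> g ` {0..dist p q}"
    using assms unfolding on_segment_def geodesic_segment_def by blast
  then obtain t where "t \<in> {0..dist p q}" "z = g t" by blast
  then show ?thesis using g(1) g(2)[of 0 t] by auto
qed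

lemma on_segment_commute: "on_segment p z q \<Longrightarrow> on_segment q z p"
  unfolding on_segment_def using geodesic_segment_commute by blast

lemma metric_tree_centre:
  fixes p q r :: "'a::metric_space"
  assumes "metric_tree TYPE('a)"
  obtains c where "on_segment p c q" "on_segment p c r" "on_segment q c r"
  using metric_tree_tripod[OF assms, of p q r] unfolding on_segment_def
  by (metis UnI1)

lemma metric_tree_on_segment_cases:
  fixes p q r z :: "'a::metric_space"
  assumes tree: "metric_tree TYPE('a)" and "on_segment p z q"
  shows "on_segment p z r \<or> on_segment q z r"
proof -
  obtain c A B C where tripod: "geodesic_segment (A \<union> B) p q" "geodesic_segment (A \<union> C) p r"
    "geodesic_segment (B \<union> C) q r"
    using metric_tree_tripod[OF tree] .
  moreover have "z \<in> A \<union> B"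
    using assms(2) metric_tree_segment_unique[OF tree _ tripod(1)]
    unfolding on_segment_def by blast
  ultimately show ?thesis
    unfolding on_segment_def by blast
qed

text \<open>
  If the image of \<open>S\<close> kept a distance of at least \<open>c + e\<close> from \<open>z\<close>, then nearby points of \<open>S\<close>,
  whose images are less than \<open>c + e\<close> apart, would have images on the same side of \<open>z\<close>.  The
  side would then be constant along the connected set \<open>S\<close>, although \<open>z\<close> separates \<open>f u\<close> from
  \<open>f v\<close>.
\<close>
lemma connected_image_near_cut_point:
  fixes f :: "'a::metric_space \<Rightarrow> 'b::metric_space"
  assumes tree: "metric_tree TYPE('b)"
    and "connected S" "u \<in> S" "v \<in> S"
    and "0 < L" "0 < e" "0 \<le> c"
    and lip: "\<And>s t. s \<in> S \<Longrightarrow> t \<in> S \<Longrightarrow> dist (f s) (f t) \<le> L * dist s t + c"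
    and z: "on_segment (f u) z (f v)"
  obtains s where "s \<in> S" "dist (f s) z < c + e"
proof -
  have "\<exists>s\<in>S. dist (f s) z < c + e"
  proof (rule ccontr)
    assume "\<not> ?thesis"
    then have far: "c + e \<le> dist (f s) z" if "s \<in> S" for s
      using that by force
    have "\<not> on_segment (f u) z (f v)"
    proof (rule connected_induction_simple[OF \<open>connected S\<close> \<open>u \<in> S\<close> \<open>v \<in> S\<close>,
          where P = "\<lambda>s. \<not> on_segment (f u) z (f s)"])
      have "0 < dist (f u) z"
        using far[OF \<open>u \<in> S\<close>] \<open>0 < e\<close> \<open>0 \<le> c\<close> by linarith
      then show "\<not> on_segment (f u) z (f u)"
        using on_segment_dist_le[of "f u" z "f u"] by auto
    next
      fix a assume "a \<in> S"
      (* With this radius, images of two points of N are less than c + e apart. *)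
      define N where "N = S \<inter> ball a (e / (2 * L))"
      have "\<not> on_segment (f u) z (f t)"
        if st: "s \<in> N" "t \<in> N" and s: "\<not> on_segment (f u) z (f s)" for s t
      proof
        assume "on_segment (f u) z (f t)"
        then have "on_segment (f t) z (f s)"
          using metric_tree_on_segment_cases[OF tree] s by blast
        then have "c + e \<le> dist (f t) (f s)"
          using on_segment_dist_le far[of t] st(2) unfolding N_def by fastforce
        moreover have "dist t s < e / (2 * L) + e / (2 * L)"
          using dist_triangle3[of t s a] st unfolding N_def by simp
        then have "L * dist t s < e"
          using \<open>0 < L\<close> by (simp add: field_simps)
        ultimately show False
          using lip[of t s] st unfolding N_def by auto
      qed
      moreover have "openin (top_of_set S) N"
        unfolding N_def by (simp add: openin_open_Int)
      moreover have "a \<in> N"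
        using \<open>a \<in> S\<close> \<open>0 < L\<close> \<open>0 < e\<close> unfolding N_def by simp
      ultimately show "\<exists>T. openin (top_of_set S) T \<and> a \<in> T \<and>
          (\<forall>s\<in>T. \<forall>t\<in>T. \<not> on_segment (f u) z (f s) \<longrightarrow> \<not> on_segment (f u) z (f t))"
        by blast
    qed
    with z show False by blast
  qed
  then show thesis using that by blast
qed

section \<open>Three separated points and the bound on the radius\<close>

text \<open>
  The third point \<open>b\<close> is found on the sphere of radius \<open>r\<close> about \<open>x\<close> by the intermediate value
  theorem for the distance from \<open>x\<close>, on a connected set that avoids the \<open>r\<close>-ball around \<open>a\<close>
  and contains both \<open>x\<close> and a remote point \<open>y\<close>.
\<close>
lemma obtain_equidistant_separated_points:
  fixes x :: "'a::metric_space"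
  assumes geo: "geodesic_space TYPE('a)"
    and conn: "\<And>(y :: 'a) z s s'. 0 < s \<Longrightarrow> 0 < s' \<Longrightarrow> s' \<le> s / 2 \<Longrightarrow>
      connected (ball y s - ball z s') \<and> ball y s - ball z s' \<noteq> {}"
    and "0 < r"
  obtains a b where "dist x a = r" "dist x b = r" "r \<le> dist a b"
proof -
  obtain y where y: "dist x y < 4 * r" "2 * r \<le> dist x y"
    using conn[of "4 * r" "2 * r" x x] \<open>0 < r\<close> by force
  obtain g where g: "g 0 = x" "g (dist x y) = y"
    "\<And>s t. s \<in> {0..dist x y} \<Longrightarrow> t \<in> {0..dist x y} \<Longrightarrow> dist (g s) (g t) = \<bar>s - t\<bar>"
    using geo unfolding geodesic_space_def geodesic_segment_def by metis
  define a where "a = g r"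
  have xa: "dist x a = r"
    using g(1) g(3)[of 0 r] y \<open>0 < r\<close> by (auto simp: a_def)
  define D where "D = ball x (4 * r) - ball a r"
  have "x \<in> D"
    using xa \<open>0 < r\<close> by (simp add: D_def dist_commute)
  moreover have "y \<in> D"
    using y xa dist_triangle[of x y a] by (simp add: D_def)
  moreover have "connected (dist x ` D)"
    using conn[of "4 * r" r x a] \<open>0 < r\<close> unfolding D_def
    by (intro connected_continuous_image continuous_intros) auto
  ultimately have "{dist x x..dist x y} \<subseteq> dist x ` D"
    by (intro connected_contains_Icc) auto
  moreover have "r \<in> {dist x x..dist x y}"
    using y \<open>0 < r\<close> by simp
  ultimately obtain b where "b \<in> D" "dist x b = r" by blast
  then show thesis
    using that[of a b] xa by (simp add: D_def)
qed

theorem proposition2: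
  fixes f :: "'a::metric_space \<Rightarrow> 'b::metric_space"
    and x :: 'a
    and R lam1 lam2 c1 c2 :: real
  assumes "geodesic_space TYPE('a)"
    and "\<And>(y :: 'a) (z :: 'a) (r :: real) (r' :: real). 0 < r \<Longrightarrow> 0 < r' \<Longrightarrow> r' \<le> r / 2 \<Longrightarrow>
           connected (ball y r - ball z r') \<and> ball y r - ball z r' \<noteq> {}"
    and "metric_tree TYPE('b)"
    and "0 < R"
    and "quasi_isometric_embedding_on lam1 lam2 c1 c2 (ball x R) f"
  shows "R \<le> 12 * lam2 * c1 + 4 * c2"
proof -
  note tree = assms(3)
  have lam: "lam1 > 0" "lam2 > 0" "c1 \<ge> 0" "c2 \<ge> 0"
    and lower: "\<And>s t. s \<in> ball x R \<Longrightarrow> t \<in> ball x R \<Longrightarrow>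
      1 / lam2 * (dist s t - c2) \<le> dist (f s) (f t)"
    and upper: "\<And>s t. s \<in> ball x R \<Longrightarrow> t \<in> ball x R \<Longrightarrow>
      dist (f s) (f t) \<le> lam1 * dist s t + c1"
    using assms(5) unfolding quasi_isometric_embedding_on_def by auto
  obtain a b where ab: "dist x a = R / 2" "dist x b = R / 2" "R / 2 \<le> dist a b"
    using obtain_equidistant_separated_points[OF assms(1,2), of "R / 2" x] \<open>0 < R\<close> by auto
  obtain z where z: "on_segment (f a) z (f b)" "on_segment (f a) z (f x)" "on_segment (f b) z (f x)"
    using metric_tree_centre[OF tree] .
  have near: "\<exists>s\<in>ball x R. R / 4 \<le> dist w s \<and> dist (f s) z < c1 + e"
    if "0 < e" and uv: "on_segment (f u) z (f v)" and "u \<in> ball x R" "v \<in> ball x R"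
      "R / 4 \<le> dist w u" "R / 4 \<le> dist w v" for u v w e
  proof -
    let ?S = "ball x R - ball w (R / 4)"
    have "connected ?S"
      using assms(2)[of R "R / 4" x w] \<open>0 < R\<close> by simp
    moreover have "u \<in> ?S" "v \<in> ?S"
      using that(3-6) by auto
    ultimately obtain s where "s \<in> ?S" "dist (f s) z < c1 + e"
      by (rule connected_image_near_cut_point[OF tree, where f = f and L = lam1 and c = c1
            and e = e and z = z]) (use lam \<open>0 < e\<close> uv upper in auto)
    then show ?thesis by (intro bexI[of _ s]) auto
  qed
  have "1 / lam2 * (R / 4 - c2) \<le> 2 * c1 + e" if "0 < e" for e
  proof -
    obtain p where p: "p \<in> ball x R" "R / 4 \<le> dist x p" "dist (f p) z < c1 + e / 2"
      using near[of "e / 2" a b x] z ab \<open>0 < e\<close> \<open>0 < R\<close> by auto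
    (* The point p cannot be within R / 4 of both a and b. *)
    obtain u where u: "R / 4 \<le> dist p u" "u \<in> ball x R" "on_segment (f u) z (f x)"
    proof (cases "R / 4 \<le> dist p a")
      case True
      then show thesis using that[of a] z ab \<open>0 < R\<close> by simp
    next
      case False
      then show thesis using that[of b] z ab \<open>0 < R\<close> dist_triangle3[of a b p] by simp
    qed
    obtain q where q: "q \<in> ball x R" "R / 4 \<le> dist p q" "dist (f q) z < c1 + e / 2"
      using near[of "e / 2" u x p] u p \<open>0 < e\<close> \<open>0 < R\<close> by (auto simp: dist_commute)
    have "1 / lam2 * (R / 4 - c2) \<le> 1 / lam2 * (dist p q - c2)"
      using q lam by (intro mult_left_mono) auto
    also have "\<dots> \<le> dist (f p) (f q)"
      using lower p q by blast
    also have "\<dots> \<le> 2 * c1 + e"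
      using dist_triangle2[of "f p" "f q" z] p(3) q(3) by simp
    finally show ?thesis .
  qed
  then have "1 / lam2 * (R / 4 - c2) \<le> 2 * c1"
    by (rule field_le_epsilon)
  then have "R \<le> 8 * (lam2 * c1) + 4 * c2"
    using lam by (simp add: field_simps)
  moreover have "0 \<le> lam2 * c1"
    using lam by simp
  ultimately show ?thesis by simp
qed

end
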